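(* Let $k\geq 2$ be an integer and let $p_k'(n)$ denote the number of coprime $k$-partitions of $n\in\mathbb{N}$. Then: (i) $p_k'$ is a $\mathbb{C}$-linear combination of the Jordan root totient functions on the entire domain $n\geq 1$; that is, there exist finitely many pairs $(t,\omega)$ with $t\in\mathbb{N}_0$ and $\omega$ a root of unity, and complex numbers $c_{t,\omega}$, such that $p_k'(n)=\sum c_{t,\omega}J_{(t,\omega)}(n)$ for all $n\geq 1$. (ii) $p_k'$ is a $\mathbb{C}$-linear combination of the Jordan modulo totient functions $J_t^{j,m}$ on the entire domain $n\geq 1$. (iii) $p_k'$ is not a $\mathbb{C}$-linear combination of the Jordan totient functions $J_t$ ($t\in\mathbb{N}_0$) on the entire domain $n\geq 1$. (iv) If there exists $N_k\in\mathbb{N}$ (depending on $k$) such that $p_k'(n)$ is a $\mathbb{C}$-linear combination of the Jordan totient functions for all $n\geq N_k$, then $p_k'(n)$ is a rational multiple of $J_{k-1}(n)$ (for $n\ge N_k$) and $k\in\{2,3\}$. Further, the minimal such value of $N_k$ is $k+1$ for both $k\in\{2,3\}$.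
   Context: A $k$-partition of $n\in\mathbb{N}$ is an unordered $k$-tuple $[x_1,\dots,x_k]$ of positive integers with $x_1+\dots+x_k=n$; it is coprime if $\gcd(x_1,\dots,x_k)=1$. $\mu$ is the Möbius function. For $t\in\mathbb{N}_0$ the Jordan totient function is $J_t(n)=\sum_{d\mid n}d^t\mu(n/d)$. For $t\in\mathbb{N}_0$ and a root of unity $\omega$, the Jordan root totient function is $J_{(t,\omega)}(n)=\sum_{d\mid n}\omega^d d^t\mu(n/d)$. For $m\in\mathbb{N}$ and $j\in\{0,1,\dots,m-1\}$, the Jordan modulo totient function is $J_t^{j,m}(n)=\sum_{d\mid n,\ d\equiv j \pmod m} d^t\mu(n/d)$. All functions are defined on $n\in\mathbb{N}$. *)

theory Defs
  imports Complex_Main "HOL-Library.Multiset" "HOL-Computational_Algebra.Squarefree"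
    "HOL-Number_Theory.Number_Theory"
begin

definition moebius :: "nat \<Rightarrow> int" where
  "moebius n = (if squarefree n then (- 1) ^ card (prime_factors n) else 0)"

(* Unordered tuples are modelled as multisets. *)
definition partitions :: "nat \<Rightarrow> nat \<Rightarrow> nat multiset set" where
  "partitions k n = {X. size X = k \<and> (\<forall>x\<in>#X. x > 0) \<and> sum_mset X = n}"

definition coprime_partitions :: "nat \<Rightarrow> nat \<Rightarrow> nat multiset set" where
  "coprime_partitions k n = {X \<in> partitions k n. Gcd (set_mset X) = 1}"

(* The next two lemmas ensure that the cardinality below is a genuine count. *)
lemma finite_partitions: "finite (partitions k n)"
proof (rule finite_subset)
  show "partitions k n \<subseteq> {X. set_mset X \<subseteq> {..n} \<and> size X = k}"
    by (auto simp: partitions_def dest: multi_member_split)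
  show "finite {X. set_mset X \<subseteq> {..n} \<and> size X = k}"
    using finite_multisets_of_size[of "{..n}" k] by (simp add: multisets_of_size_def)
qed

lemma finite_coprime_partitions: "finite (coprime_partitions k n)"
  by (simp add: coprime_partitions_def finite_partitions)

definition num_coprime_partitions :: "nat \<Rightarrow> nat \<Rightarrow> nat" where
  "num_coprime_partitions k n = card (coprime_partitions k n)"

definition jordan_totient :: "nat \<Rightarrow> nat \<Rightarrow> int" where
  "jordan_totient t n = (\<Sum>d | d dvd n. int d ^ t * moebius (n div d))"

definition root_of_unity :: "complex \<Rightarrow> bool" where
  "root_of_unity \<omega> \<longleftrightarrow> (\<exists>m::nat. m \<ge> 1 \<and> \<omega> ^ m = 1)"

definition jordan_root_totient :: "nat \<Rightarrow> complex \<Rightarrow> nat \<Rightarrow> complex" where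
  "jordan_root_totient t \<omega> n =
     (\<Sum>d | d dvd n. \<omega> ^ d * of_nat d ^ t * of_int (moebius (n div d)))"

definition jordan_mod_totient :: "nat \<Rightarrow> nat \<Rightarrow> nat \<Rightarrow> nat \<Rightarrow> int" where
  "jordan_mod_totient t j m n =
     (\<Sum>d | d dvd n \<and> [d = j] (mod m). int d ^ t * moebius (n div d))"

(* On D, the function f agrees with a finite complex linear combination of the
   functions g i, i in I. *)
definition lin_comb_on ::
    "nat set \<Rightarrow> ('i \<Rightarrow> nat \<Rightarrow> complex) \<Rightarrow> 'i set \<Rightarrow> (nat \<Rightarrow> complex) \<Rightarrow> bool" where
  "lin_comb_on D g I f \<longleftrightarrow>
     (\<exists>S c. finite S \<and> S \<subseteq> I \<and> (\<forall>n\<in>D. f n = (\<Sum>i\<in>S. c i * g i n)))"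

abbreviation lin_comb_jordan_on :: "nat set \<Rightarrow> (nat \<Rightarrow> complex) \<Rightarrow> bool" where
  "lin_comb_jordan_on D f \<equiv> lin_comb_on D (\<lambda>t n. of_int (jordan_totient t n)) UNIV f"

end

theory Submission
  imports Defs "HOL-Computational_Algebra.Polynomial"
begin

text \<open>
  Let \<open>p\<^sub>k(n)\<close> count all \<open>k\<close>-partitions of \<open>n\<close>. Sorting them by their gcd gives
  \<open>p\<^sub>k(n) = (\<Sum>d | d dvd n. p\<^sub>k'(d))\<close>, and the recurrence
  \<open>p\<^sub>k\<^sub>+\<^sub>1(n + k + 1) = p\<^sub>k(n + k) + p\<^sub>k\<^sub>+\<^sub>1(n)\<close> shows that \<open>p\<^sub>k\<close> is a quasi-polynomial on
  \<open>n \<ge> 1\<close>; Moebius inversion of its constituents yields the modulo totients, and a roots-of-unity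
  filter turns these into root totients.

  If \<open>p\<^sub>k'\<close> is eventually a combination of Jordan totients, then inverting back shows that \<open>p\<^sub>k\<close> is
  a polynomial plus a periodic function. By the recurrence this property descends from \<open>k + 1\<close> to
  \<open>k\<close>, and it fails for \<open>k = 4\<close> because \<open>p\<^sub>4(n + 12) - p\<^sub>4(n)\<close> is a polynomial up to a
  nonzero multiple of \<open>(-1)\<^sup>n\<close>. For \<open>k = 2, 3\<close> the closed forms of \<open>p\<^sub>k\<close> give \<open>p\<^sub>k'\<close> as a multiple
  of \<open>J\<^sub>k\<^sub>-\<^sub>1\<close> plus a function supported on \<open>{1..k}\<close>.
\<close>

section \<open>Moebius inversion\<close>

lemma moebius_1 [simp]: "moebius (Suc 0) = 1"
  by (simp add: moebius_def)

lemma moebius_prime_mult: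
  assumes "prime p" "\<not> p dvd d"
  shows "moebius (p * d) = - moebius d"
proof -
  have cop: "coprime p d" using assms by (simp add: prime_imp_coprime)
  have d0: "d \<noteq> 0" using assms by (metis dvd_0_right)
  have sq: "squarefree (p * d) \<longleftrightarrow> squarefree d"
    using cop assms(1) squarefree_mult_coprime[of p d] squarefree_multD(2)[of p d] squarefree_prime
    by blast
  have pf: "prime_factors (p * d) = insert p (prime_factors d)"
    using assms d0 by (simp add: prime_factors_product prime_prime_factors)
  have "p \<notin> prime_factors d" using assms by auto
  with sq pf show ?thesis by (simp add: moebius_def)
qed

text \<open>Fix a prime \<open>p\<close> dividing \<open>n\<close>. Divisors divisible by the square
  of \<open>p\<close> contribute nothing; the others pair off as \<open>d\<close> and
  \<open>p * d\<close> with \<open>d\<close> prime to \<open>p\<close>, and the two values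
  cancel.\<close>

lemma sum_moebius_divisors:
  assumes "n > 0"
  shows "(\<Sum>d | d dvd n. moebius d) = (if n = 1 then 1 else 0)"
proof (cases "n = 1")
  case False
  then obtain p where p: "prime p" "p dvd n" using prime_factor_nat by blast
  define A where "A = {d. d dvd n \<and> \<not> p dvd d}"
  have fin: "finite {d. d dvd n}" using assms by simp
  have finA: "finite A" unfolding A_def by (rule finite_subset[OF _ fin]) auto
  have p0: "p > 0" using p prime_gt_0_nat by blast
  have sub: "A \<union> (*) p ` A \<subseteq> {d. d dvd n}"
    using p by (auto simp: A_def intro!: divides_mult dest: prime_imp_coprime)
  have "(\<Sum>d | d dvd n. moebius d) = (\<Sum>d \<in> A \<union> (*) p ` A. moebius d)"
  proof (rule sum.mono_neutral_right[OF fin sub], rule ballI)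
    fix d assume d: "d \<in> {d. d dvd n} - (A \<union> (*) p ` A)"
    then have "p dvd d" by (auto simp: A_def)
    then obtain e where e: "d = p * e" by blast
    with d have "p dvd e" by (auto simp: A_def dest: dvd_mult_right)
    then have "p\<^sup>2 dvd d" using e by (simp add: power2_eq_square)
    then have "\<not> squarefree d" using p(1) unfolding squarefree_def
      by (metis not_prime_unit)
    then show "moebius d = 0" by (simp add: moebius_def)
  qed
  also have "\<dots> = (\<Sum>d\<in>A. moebius d) + (\<Sum>d\<in>(*) p ` A. moebius d)"
    using finA by (intro sum.union_disjoint) (auto simp: A_def)
  also have "(\<Sum>d\<in>(*) p ` A. moebius d) = (\<Sum>d\<in>A. moebius (p * d))"
    using p0 by (subst sum.reindex) (auto simp: inj_on_def)
  also have "\<dots> = - (\<Sum>d\<in>A. moebius d)"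
    using p(1) by (simp add: A_def moebius_prime_mult sum_negf)
  finally show ?thesis using False by simp
qed simp

text \<open>After exchanging the sums, \<open>f e\<close> is multiplied by the sum of
  \<open>moebius\<close> over the divisors of \<open>n div e\<close>, which vanishes unless
  \<open>e = n\<close>.\<close>

lemma sum_divisors_moebius_convolution:
  fixes f :: "nat \<Rightarrow> 'a :: comm_ring_1"
  assumes "n > 0"
  shows "(\<Sum>d | d dvd n. \<Sum>e | e dvd d. f e * of_int (moebius (d div e))) = f n"
proof -
  have fin: "finite {d. d dvd n}" using assms by simp
  have inner: "(\<Sum>d | d dvd n \<and> e dvd d. moebius (d div e)) = (if e = n then 1 else 0)"
    if "e dvd n" for e
  proof -
    have e0: "e > 0" and n: "n = e * (n div e)" using that assms by (auto intro: Nat.gr0I)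
    have nd: "n div e > 0" using n assms by (metis gr0I mult_0_right)
    have "(\<Sum>d | d dvd n \<and> e dvd d. moebius (d div e)) = (\<Sum>c | c dvd n div e. moebius c)"
      by (rule sum.reindex_bij_witness[of _ "\<lambda>c. e * c" "\<lambda>d. d div e"])
         (use e0 that in \<open>auto simp: dvd_div_iff_mult mult.commute div_dvd_div\<close>)
    also have "\<dots> = (if e = n then 1 else 0)"
      using sum_moebius_divisors[OF nd] n e0 by auto
    finally show ?thesis .
  qed
  have "(\<Sum>d | d dvd n. \<Sum>e | e dvd d. f e * of_int (moebius (d div e)))
      = (\<Sum>d | d dvd n. \<Sum>e | e dvd n \<and> e dvd d. f e * of_int (moebius (d div e)))"
    by (intro sum.cong refl) (auto dest: dvd_trans)
  also have "\<dots> = (\<Sum>e | e dvd n. \<Sum>d | d dvd n \<and> e dvd d. f e * of_int (moebius (d div e)))"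
    using sum.swap_restrict[OF fin fin, of "\<lambda>d e. f e * of_int (moebius (d div e))" "\<lambda>d e. e dvd d"]
    by simp
  also have "\<dots> = (\<Sum>e | e dvd n. f e * of_int (\<Sum>d | d dvd n \<and> e dvd d. moebius (d div e)))"
    by (simp add: sum_distrib_left)
  also have "\<dots> = (\<Sum>e | e dvd n. if e = n then f e else 0)"
    by (intro sum.cong refl) (simp add: inner)
  also have "\<dots> = f n" using fin by simp
  finally show ?thesis .
qed

text \<open>By strong induction: \<open>f n\<close> is the divisor sum at \<open>n\<close> minus the
  values at proper divisors. Identities between arithmetic functions can thus be checked on their
  divisor sums.\<close>

lemma sum_divisors_cancel:
  fixes f g :: "nat \<Rightarrow> 'a :: ab_group_add"
  assumes eq: "\<And>n. n > 0 \<Longrightarrow> (\<Sum>d | d dvd n. f d) = (\<Sum>d | d dvd n. g d)" and "n > 0"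
  shows "f n = g n"
  using \<open>n > 0\<close>
proof (induction n rule: less_induct)
  case (less n)
  have fin: "finite {d. d dvd n}" using less.prems by simp
  have split: "(\<Sum>d | d dvd n. h d) = h n + (\<Sum>d\<in>{d. d dvd n} - {n}. h d)" for h :: "nat \<Rightarrow> 'a"
    using fin by (simp add: sum.remove)
  have "(\<Sum>d\<in>{d. d dvd n} - {n}. f d) = (\<Sum>d\<in>{d. d dvd n} - {n}. g d)"
  proof (rule sum.cong[OF refl])
    fix d assume "d \<in> {d. d dvd n} - {n}"
    then have "d < n" "d > 0" using less.prems by (auto dest: dvd_imp_le intro: Nat.gr0I)
    then show "f d = g d" by (rule less.IH)
  qed
  with eq[OF less.prems] show ?case by (simp add: split)
qed

lemma sum_divisors_jordan_totient:
  assumes "n > 0"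
  shows "(\<Sum>d | d dvd n. jordan_totient t d) = int n ^ t"
  using sum_divisors_moebius_convolution[OF assms, of "\<lambda>d. int d ^ t"]
  by (simp add: jordan_totient_def)

lemma jordan_totient_prime:
  assumes "prime p"
  shows "jordan_totient t p = int p ^ t - 1"
proof -
  have "{d. d dvd p} = {1, p}" using assms by (auto simp: prime_nat_iff)
  moreover have "p \<noteq> 1" using assms by auto
  ultimately have "(\<Sum>d | d dvd p. jordan_totient t d) = jordan_totient t 1 + jordan_totient t p"
    by simp
  moreover have "jordan_totient t 1 = 1"
    using sum_divisors_jordan_totient[of 1 t] by simp
  ultimately show ?thesis
    using sum_divisors_jordan_totient[of p t] prime_gt_0_nat[OF assms] by simp
qed

section \<open>Counting partitions\<close>

abbreviation num_partitions :: "nat \<Rightarrow> nat \<Rightarrow> nat" where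
  "num_partitions k n \<equiv> card (partitions k n)"

lemma partitions_size_le:
  assumes "X \<in> partitions k n"
  shows "k \<le> n"
proof -
  have "size X \<le> sum_mset X" if "\<forall>x\<in>#X. x > 0" for X :: "nat multiset"
    using that by (induction X) auto
  with assms show ?thesis by (auto simp: partitions_def)
qed

lemma num_partitions_eq_0: "n < k \<Longrightarrow> num_partitions k n = 0"
  using partitions_size_le[of _ k n] by (auto simp: card_eq_0_iff)

lemma sum_mset_image_Suc: "sum_mset (image_mset Suc X) = sum_mset X + size X"
  by (induction X) auto

text \<open>From a partition containing a 1, one such part is removed; in any other, all parts are
  lowered by 1 and stay positive. The shifted arguments avoid subtraction on naturals.\<close>

lemma num_partitions_rec:
  "num_partitions (Suc k) (n + Suc k) = num_partitions k (n + k) + num_partitions (Suc k) n"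
proof -
  let ?A = "add_mset 1 ` partitions k (n + k)"
  let ?B = "image_mset Suc ` partitions (Suc k) n"
  have "X \<in> ?A \<union> ?B" if X: "X \<in> partitions (Suc k) (n + Suc k)" for X
  proof (cases "1 \<in># X")
    case True
    then obtain Y where Y: "X = add_mset 1 Y" by (auto dest: multi_member_split)
    with X have "Y \<in> partitions k (n + k)" by (auto simp: partitions_def)
    with Y show ?thesis by blast
  next
    case False
    define Y where "Y = image_mset (\<lambda>x. x - 1) X"
    have *: "x > 1" if "x \<in># X" for x
      using that X False by (cases "x = 1") (auto simp: partitions_def intro: Suc_lessI)
    have XY: "X = image_mset Suc Y"
      unfolding Y_def multiset.map_comp
      by (rule sym, rule multiset.map_ident_strong) (auto dest: *)
    have "size X = size Y" by (simp add: Y_def)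
    with X XY have "sum_mset Y = n" "size Y = Suc k"
      by (auto simp: partitions_def sum_mset_image_Suc)
    with * have "Y \<in> partitions (Suc k) n" by (auto simp: partitions_def Y_def)
    with XY show ?thesis by blast
  qed
  moreover have "?A \<subseteq> partitions (Suc k) (n + Suc k)" "?B \<subseteq> partitions (Suc k) (n + Suc k)"
    by (auto simp: partitions_def sum_mset_image_Suc)
  ultimately have eq: "partitions (Suc k) (n + Suc k) = ?A \<union> ?B" by blast
  have "?A \<inter> ?B = {}"
  proof -
    have "False" if "Y \<in> partitions (Suc k) n" "add_mset 1 X = image_mset Suc Y" for X Y
    proof -
      have "1 \<in># image_mset Suc Y" by (simp flip: that(2))
      then show False using that(1) by (auto simp: partitions_def)
    qed
    then show ?thesis by blast
  qed
  moreover have "card ?A = num_partitions k (n + k)"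
    by (rule card_image) (simp add: inj_on_def)
  moreover have "card ?B = num_partitions (Suc k) n"
    by (rule card_image) (auto intro: inj_on_subset[OF multiset.inj_map])
  ultimately show ?thesis
    unfolding eq by (simp add: card_Un_disjoint finite_partitions)
qed

lemma num_partitions_1: "n > 0 \<Longrightarrow> num_partitions 1 n = 1"
proof -
  assume "n > 0"
  then have "partitions 1 n = {{#n#}}"
    using size_1_singleton_mset by (fastforce simp: partitions_def)
  then show ?thesis by simp
qed

section \<open>Sorting partitions by their gcd\<close>

text \<open>Multiplying all parts by \<open>g\<close> is a bijection from the coprime partitions;
  its inverse divides all parts by \<open>g\<close>.\<close>

lemma num_coprime_partitions_image:
  assumes "g > 0"
  shows "card {X \<in> partitions k (g * m). Gcd (set_mset X) = g} = num_coprime_partitions k m"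
proof -
  have "{X \<in> partitions k (g * m). Gcd (set_mset X) = g} = image_mset ((*) g) ` coprime_partitions k m"
  proof (intro equalityI subsetI)
    fix X assume X: "X \<in> {X \<in> partitions k (g * m). Gcd (set_mset X) = g}"
    define Y where "Y = image_mset (\<lambda>x. x div g) X"
    have dvd: "g dvd x" if "x \<in># X" for x using that X by auto
    have XY: "X = image_mset ((*) g) Y"
      unfolding Y_def multiset.map_comp
      by (rule sym, rule multiset.map_ident_strong) (auto dest: dvd)
    have "g * sum_mset Y = g * m" using X XY sum_mset_distrib_left[of g "\<lambda>x. x" Y]
      by (simp add: partitions_def)
    moreover have "g * Gcd (set_mset Y) = g * 1" using X XY
      by (simp add: Gcd_mult)
    moreover have "size Y = k" "\<forall>x\<in>#Y. x > 0"
      using X dvd by (auto simp: partitions_def Y_def div_greater_zero_iff assms intro!: dvd_imp_le)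
    ultimately have "Y \<in> coprime_partitions k m"
      using assms by (simp add: coprime_partitions_def partitions_def)
    with XY show "X \<in> image_mset ((*) g) ` coprime_partitions k m" by blast
  next
    fix X assume "X \<in> image_mset ((*) g) ` coprime_partitions k m"
    then show "X \<in> {X \<in> partitions k (g * m). Gcd (set_mset X) = g}"
      using assms by (auto simp: coprime_partitions_def partitions_def Gcd_mult simp flip: sum_mset_distrib_left[where f = "\<lambda>x. x"])
  qed
  moreover have "inj (image_mset ((*) g))"
    using assms by (intro multiset.inj_map) (simp add: inj_def)
  ultimately show ?thesis
    by (simp add: num_coprime_partitions_def card_image inj_on_subset)
qed

lemma dvd_sum_mset:
  fixes d :: "'a :: comm_semiring_1"
  shows "(\<And>x. x \<in># X \<Longrightarrow> d dvd x) \<Longrightarrow> d dvd sum_mset X"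
  by (induction X) auto

text \<open>The gcd of the parts divides \<open>n\<close>. Grouping by this gcd \<open>g\<close>
  gives the coprime counts at \<open>n div g\<close>, and \<open>g\<close> is then exchanged for its
  complementary divisor.\<close>

lemma sum_divisors_num_coprime_partitions:
  assumes "n > 0"
  shows "(\<Sum>d | d dvd n. num_coprime_partitions k d) = num_partitions k n"
proof -
  have fin: "finite {d. d dvd n}" using assms by simp
  have gcd_dvd: "Gcd (set_mset X) dvd n" if "X \<in> partitions k n" for X
    using that dvd_sum_mset[of X "Gcd (set_mset X)"] by (auto simp: partitions_def)
  have "num_partitions k n = (\<Sum>X\<in>partitions k n. 1)" by simp
  also have "\<dots> = (\<Sum>g | g dvd n. \<Sum>X\<in>{X\<in>partitions k n. Gcd (set_mset X) = g}. 1)"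
    by (rule sum.group[symmetric]) (use fin gcd_dvd in \<open>auto simp: finite_partitions\<close>)
  also have "\<dots> = (\<Sum>g | g dvd n. num_coprime_partitions k (n div g))"
  proof (rule sum.cong[OF refl])
    fix g assume g: "g \<in> {g. g dvd n}"
    then have "g > 0" "n = g * (n div g)" using assms by (auto intro: Nat.gr0I)
    then show "(\<Sum>X\<in>{X\<in>partitions k n. Gcd (set_mset X) = g}. 1) = num_coprime_partitions k (n div g)"
      using num_coprime_partitions_image[of g k "n div g"] by simp
  qed
  also have "\<dots> = (\<Sum>d | d dvd n. num_coprime_partitions k d)"
    by (rule sum.reindex_bij_witness[of _ "\<lambda>d. n div d" "\<lambda>d. n div d"])
       (use assms in \<open>auto simp: div_dvd_iff_mult\<close>)
  finally show ?thesis by simp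
qed

text \<open>A sum equal to the number of parts forces every part to be 1. This value later shows
  that the threshold \<open>k + 1\<close> is minimal.\<close>

lemma num_coprime_partitions_self: "k > 0 \<Longrightarrow> num_coprime_partitions k k = 1"
proof -
  assume k: "k > 0"
  have *: "X = replicate_mset (size X) 1" if "\<forall>x\<in>#X. x > 0" "sum_mset X = size X" for X :: "nat multiset"
    using that
  proof (induction X)
    case (add x X)
    have "size X \<le> sum_mset X" using partitions_size_le[of X "size X" "sum_mset X"] add.prems
      by (simp add: partitions_def)
    with add show ?case by auto
  qed simp
  have "coprime_partitions k k = {replicate_mset k 1}"
    using k * by (force simp: coprime_partitions_def partitions_def)
  then show ?thesis by (simp add: num_coprime_partitions_def)
qed


section \<open>Quasi-polynomials\<close>

text \<open>The differences of consecutive powers with exponent \<open>Suc t\<close> telescope.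
  Expanding them binomially and solving for the top term expresses the sum by power sums of lower
  exponent.\<close>

lemma sum_power_poly:
  "\<exists>S :: 'a :: field_char_0 poly. \<forall>s. (\<Sum>i<s. of_nat i ^ t) = poly S (of_nat s)"
proof (induction t rule: less_induct)
  case (less t)
  then obtain S :: "nat \<Rightarrow> 'a poly"
    where S: "\<And>j s. j < t \<Longrightarrow> (\<Sum>i<s. of_nat i ^ j) = poly (S j) (of_nat s)"
    by metis
  define Q where "Q = smult (1 / of_nat (Suc t))
    (monom 1 (Suc t) - (\<Sum>j<t. smult (of_nat (Suc t choose j)) (S j)))"
  have "(\<Sum>i<s. of_nat i ^ t) = poly Q (of_nat s)" for s
  proof -
    have step: "of_nat (Suc i) ^ Suc t - of_nat i ^ Suc t =
        (\<Sum>j<t. of_nat (Suc t choose j) * of_nat i ^ j) + of_nat (Suc t) * (of_nat i ^ t :: 'a)" for i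
    proof -
      have "of_nat (Suc i) ^ Suc t = (\<Sum>j\<le>Suc t. of_nat (Suc t choose j) * (of_nat i :: 'a) ^ j)"
        using binomial_ring[of "of_nat i :: 'a" 1 "Suc t"] by (simp add: add.commute)
      then show ?thesis
        by (simp add: lessThan_Suc_atMost [symmetric] del: power_Suc of_nat_Suc binomial_Suc_Suc)
    qed
    have "of_nat s ^ Suc t = (\<Sum>i<s. of_nat (Suc i) ^ Suc t - of_nat i ^ Suc t :: 'a)"
      using sum_lessThan_telescope[of "\<lambda>i. of_nat i ^ Suc t :: 'a" s] by simp
    also have "\<dots> = (\<Sum>j<t. of_nat (Suc t choose j) * (\<Sum>i<s. of_nat i ^ j)) +
        of_nat (Suc t) * (\<Sum>i<s. of_nat i ^ t)"
      unfolding step sum.distrib sum_distrib_left by (subst sum.swap) simp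
    also have "(\<Sum>j<t. of_nat (Suc t choose j) * (\<Sum>i<s. of_nat i ^ j)) =
        (\<Sum>j<t. of_nat (Suc t choose j) * poly (S j) (of_nat s))"
      by (intro sum.cong refl) (simp add: S)
    finally show ?thesis
      by (simp add: Q_def poly_sum poly_monom field_simps del: of_nat_Suc binomial_Suc_Suc)
  qed
  then show ?case by blast
qed

lemma sum_poly_poly:
  fixes R :: "'a :: field_char_0 poly"
  shows "\<exists>S. \<forall>s. (\<Sum>i<s. poly R (of_nat i)) = poly S (of_nat s)"
proof -
  obtain S :: "nat \<Rightarrow> 'a poly" where S: "\<And>t s. (\<Sum>i<s. of_nat i ^ t) = poly (S t) (of_nat s)"
    using sum_power_poly by metis
  have "(\<Sum>i<s. poly R (of_nat i)) = poly (\<Sum>t\<le>degree R. smult (coeff R t) (S t)) (of_nat s)" for s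
    by (simp add: poly_altdef[of R] poly_sum S[symmetric] sum_distrib_left)
       (rule sum.swap)
  then show ?thesis by blast
qed

(* Only n > 0 is required: the constant function p_1 = 1 fails at n = 0. *)
definition quasi_poly :: "(nat \<Rightarrow> complex) \<Rightarrow> bool" where
  "quasi_poly f \<longleftrightarrow> (\<exists>m>0. \<exists>P. \<forall>n>0. f n = poly (P (n mod m)) (of_nat n))"

text \<open>Taking \<open>m\<close> steps of length \<open>a\<close> moves the argument by
  \<open>M = m * a\<close>, a multiple of the period of \<open>f\<close>. On each residue class
  modulo \<open>M\<close> the increment of \<open>g\<close> is then a polynomial in the block index,
  and summing it gives a polynomial again.\<close>

lemma quasi_poly_step:
  assumes f: "quasi_poly f" and rec: "\<And>n. g (n + a) = g n + f (n + b)" and "a > 0" "b > 0"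
  shows "quasi_poly g"
proof -
  obtain m P where m: "m > 0" and P: "\<And>n. n > 0 \<Longrightarrow> f n = poly (P (n mod m)) (of_nat n)"
    using f by (auto simp: quasi_poly_def)
  define M where "M = m * a"
  have M: "M > 0" using m \<open>a > 0\<close> by (simp add: M_def)
  \<comment> \<open>\<open>R r\<close> at \<open>s\<close> is the increment of \<open>g\<close> over
    the block of length \<open>M\<close> that starts at \<open>r + M * s\<close>.\<close>
  define R where "R r = (\<Sum>i<m. pcompose (P ((r + i * a + b) mod m)) [:of_nat (r + i * a + b), of_nat M:])" for r
  have "\<forall>r. \<exists>S. \<forall>s. (\<Sum>i<s. poly (R r) (of_nat i)) = poly S (of_nat s)"
    using sum_poly_poly by blast
  then obtain S where S: "\<And>r s. (\<Sum>i<s. poly (R r) (of_nat i)) = poly (S r) (of_nat s)"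
    by metis
  have multi: "g (n + a * l) = g n + (\<Sum>i<l. f (n + i * a + b))" for n l
  proof (induction l)
    case (Suc l)
    have "g (n + a * Suc l) = g (n + a * l + a)" by (simp add: algebra_simps)
    with Suc show ?case by (simp add: rec mult.commute)
  qed simp
  have block: "g (r + M * s + M) = g (r + M * s) + poly (R r) (of_nat s)" for r s
  proof -
    have "f (r + M * s + i * a + b) = poly (P ((r + i * a + b) mod m)) (of_nat (r + i * a + b) + of_nat M * of_nat s)" for i
    proof -
      have "(r + M * s + i * a + b) mod m = (r + i * a + b + m * (a * s)) mod m"
        by (simp add: M_def algebra_simps)
      also have "\<dots> = (r + i * a + b) mod m" by simp
      \<comment> \<open>\<open>b > 0\<close> makes the argument positive, which is where
        \<open>P\<close> describes \<open>f\<close>.\<close>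
      finally show ?thesis using P[of "r + M * s + i * a + b"] \<open>b > 0\<close>
        by (simp add: algebra_simps)
    qed
    then show ?thesis using multi[of "r + M * s" m]
      by (simp add: R_def poly_sum poly_pcompose M_def mult.commute)
  qed
  have closed: "g (r + M * s) = g r + poly (S r) (of_nat s)" for r s
  proof -
    have "g (r + M * s) = g r + (\<Sum>i<s. poly (R r) (of_nat i))"
    proof (induction s)
      case (Suc s)
      have "g (r + M * Suc s) = g (r + M * s + M)" by (simp add: algebra_simps)
      with Suc show ?case by (simp add: block)
    qed simp
    with S show ?thesis by simp
  qed
  \<comment> \<open>The inner linear polynomial recovers the block index \<open>(n - r) / M\<close>
    from \<open>n\<close>.\<close>
  define Q where "Q r = [:g r:] + pcompose (S r) [:- of_nat r / of_nat M, 1 / of_nat M:]" for r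
  have "g n = poly (Q (n mod M)) (of_nat n)" for n
  proof -
    have "(of_nat n :: complex) = of_nat (n mod M + M * (n div M))" by simp
    also have "\<dots> = of_nat (n mod M) + of_nat M * of_nat (n div M)"
      by (simp only: of_nat_add of_nat_mult)
    finally have "- of_nat (n mod M) / of_nat M + of_nat n * (1 / of_nat M) = (of_nat (n div M) :: complex)"
      using M by (simp add: field_simps)
    then show ?thesis using closed[of "n mod M" "n div M"]
      by (simp add: Q_def poly_pcompose)
  qed
  with M show ?thesis unfolding quasi_poly_def by blast
qed

lemma quasi_poly_num_partitions:
  assumes "k > 0"
  shows "quasi_poly (\<lambda>n. of_nat (num_partitions k n))"
  using assms
proof (induction k rule: nat_induct_non_zero)
  case 1
  have "\<forall>n>0. of_nat (num_partitions 1 n) = poly 1 (of_nat n :: complex)"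
    using num_partitions_1 by simp
  then show ?case unfolding quasi_poly_def by (intro exI[of _ 1] exI[of _ "\<lambda>_. 1"] conjI) simp_all
next
  case (Suc k)
  show ?case
    by (rule quasi_poly_step[OF Suc.IH, of _ "Suc k" k])
       (use \<open>k > 0\<close> in \<open>simp_all only: num_partitions_rec of_nat_add add.commute zero_less_Suc\<close>)
qed

section \<open>Linear combinations of totient functions\<close>

lemma lin_comb_on_single: "i \<in> I \<Longrightarrow> lin_comb_on D g I (g i)"
  unfolding lin_comb_on_def by (intro exI[of _ "{i}"] exI[of _ "\<lambda>_. 1"]) auto

lemma lin_comb_on_scale:
  assumes "lin_comb_on D g I f"
  shows "lin_comb_on D g I (\<lambda>n. a * f n)"
proof -
  obtain S c where S: "finite S" "S \<subseteq> I" "\<forall>n\<in>D. f n = (\<Sum>i\<in>S. c i * g i n)"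
    using assms unfolding lin_comb_on_def by blast
  then have "\<forall>n\<in>D. a * f n = (\<Sum>i\<in>S. (a * c i) * g i n)"
    by (simp add: sum_distrib_left mult.assoc)
  with S show ?thesis unfolding lin_comb_on_def
    by (intro exI[of _ S] exI[of _ "\<lambda>i. a * c i"]) auto
qed

lemma lin_comb_on_add:
  assumes "lin_comb_on D g I f1" "lin_comb_on D g I f2"
  shows "lin_comb_on D g I (\<lambda>n. f1 n + f2 n)"
proof -
  obtain S c where S: "finite S" "S \<subseteq> I" "\<forall>n\<in>D. f1 n = (\<Sum>i\<in>S. c i * g i n)"
    using assms(1) unfolding lin_comb_on_def by blast
  obtain T d where T: "finite T" "T \<subseteq> I" "\<forall>n\<in>D. f2 n = (\<Sum>i\<in>T. d i * g i n)"
    using assms(2) unfolding lin_comb_on_def by blast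
  \<comment> \<open>Both coefficient families are extended by 0 to the union, so that common indices
    add up.\<close>
  define e where "e i = (if i \<in> S then c i else 0) + (if i \<in> T then d i else 0)" for i
  have "f1 n + f2 n = (\<Sum>i\<in>S \<union> T. e i * g i n)" if "n \<in> D" for n
  proof -
    have "f1 n = (\<Sum>i\<in>S \<union> T. (if i \<in> S then c i else 0) * g i n)"
      using S T that by (auto intro!: sum.mono_neutral_cong_left)
    moreover have "f2 n = (\<Sum>i\<in>S \<union> T. (if i \<in> T then d i else 0) * g i n)"
      using S T that by (auto intro!: sum.mono_neutral_cong_left)
    ultimately show ?thesis by (simp add: e_def distrib_right sum.distrib)
  qed
  with S T show ?thesis unfolding lin_comb_on_def
    by (intro exI[of _ "S \<union> T"] exI[of _ e]) auto
qed

lemma lin_comb_on_sum: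
  assumes "finite A" "\<And>a. a \<in> A \<Longrightarrow> lin_comb_on D g I (F a)"
  shows "lin_comb_on D g I (\<lambda>n. \<Sum>a\<in>A. F a n)"
  using assms
proof (induction A rule: finite_induct)
  case empty
  show ?case unfolding lin_comb_on_def by (intro exI[of _ "{}"]) auto
qed (simp add: lin_comb_on_add)

lemma lin_comb_on_cong:
  assumes "lin_comb_on D g I f" "\<And>n. n \<in> D \<Longrightarrow> f n = f' n"
  shows "lin_comb_on D g I f'"
  using assms unfolding lin_comb_on_def by simp

lemma lin_comb_on_trans:
  assumes "lin_comb_on D g I f" "\<And>i. i \<in> I \<Longrightarrow> lin_comb_on D g' I' (g i)"
  shows "lin_comb_on D g' I' f"
proof -
  obtain S c where S: "finite S" "S \<subseteq> I" "\<forall>n\<in>D. f n = (\<Sum>i\<in>S. c i * g i n)"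
    using assms(1) unfolding lin_comb_on_def by blast
  have "lin_comb_on D g' I' (\<lambda>n. \<Sum>i\<in>S. c i * g i n)"
    using S assms(2) by (intro lin_comb_on_sum lin_comb_on_scale) auto
  then show ?thesis by (rule lin_comb_on_cong) (use S in auto)
qed

text \<open>Both sides have the divisor sum \<open>num_partitions k n\<close>, hence they
  coincide.\<close>

lemma num_coprime_partitions_eq_moebius_sum:
  assumes "n > 0"
  shows "of_nat (num_coprime_partitions k n) =
    (\<Sum>d | d dvd n. of_nat (num_partitions k d) * of_int (moebius (n div d)) :: complex)"
  using assms
proof (rule sum_divisors_cancel[rotated])
  fix n :: nat assume "n > 0"
  then show "(\<Sum>d | d dvd n. of_nat (num_coprime_partitions k d)) =
    (\<Sum>d | d dvd n. \<Sum>e | e dvd d. of_nat (num_partitions k e) * of_int (moebius (d div e)) :: complex)"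
    unfolding sum_divisors_moebius_convolution[OF \<open>n > 0\<close>]
      sum_divisors_num_coprime_partitions[OF \<open>n > 0\<close>, symmetric] by simp
qed

text \<open>The quasi-polynomial for \<open>num_partitions k\<close> is inserted into the Moebius
  sum. The coefficient of degree \<open>t\<close> of the constituent for residue \<open>j\<close>
  becomes the coefficient of the modulo totient with index \<open>(t, j, m)\<close>.\<close>

lemma lin_comb_jordan_mod_totient:
  assumes "k > 0"
  shows "lin_comb_on {1..} (\<lambda>(t, j, m) n. of_int (jordan_mod_totient t j m n))
    {(t, j, m). m \<ge> 1 \<and> j < m} (\<lambda>n. of_nat (num_coprime_partitions k n))"
    (is "lin_comb_on _ ?g ?I _")
proof -
  obtain m P where m: "m > 0"
    and P: "\<And>n. n > 0 \<Longrightarrow> of_nat (num_partitions k n) = poly (P (n mod m)) (of_nat n :: complex)"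
    using quasi_poly_num_partitions[OF assms] by (auto simp: quasi_poly_def)
  have "lin_comb_on {1..} ?g ?I (\<lambda>n. \<Sum>j<m. \<Sum>t\<le>degree (P j). coeff (P j) t * ?g (t, j, m) n)"
    using m by (intro lin_comb_on_sum lin_comb_on_scale lin_comb_on_single) auto
  then show ?thesis
  proof (rule lin_comb_on_cong)
    fix n :: nat assume "n \<in> {1..}"
    then have n: "n > 0" by simp
    have "(\<Sum>j<m. \<Sum>t\<le>degree (P j). coeff (P j) t * ?g (t, j, m) n) =
        (\<Sum>j<m. \<Sum>d | d dvd n \<and> [d = j] (mod m). poly (P j) (of_nat d) * of_int (moebius (n div d)))"
    proof (rule sum.cong[OF refl])
      fix j
      have "(\<Sum>t\<le>degree (P j). coeff (P j) t * ?g (t, j, m) n) =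
        (\<Sum>t\<le>degree (P j). \<Sum>d | d dvd n \<and> [d = j] (mod m).
           coeff (P j) t * (of_nat d ^ t * of_int (moebius (n div d))))"
        by (simp add: jordan_mod_totient_def sum_distrib_left)
      also have "\<dots> = (\<Sum>d | d dvd n \<and> [d = j] (mod m). poly (P j) (of_nat d) * of_int (moebius (n div d)))"
        by (subst sum.swap) (simp add: poly_altdef sum_distrib_right mult.assoc)
      finally show "(\<Sum>t\<le>degree (P j). coeff (P j) t * ?g (t, j, m) n) =
        (\<Sum>d | d dvd n \<and> [d = j] (mod m). poly (P j) (of_nat d) * of_int (moebius (n div d)))" .
    qed
    also have "\<dots> = (\<Sum>j<m. \<Sum>d | d dvd n \<and> d mod m = j. of_nat (num_partitions k d) * of_int (moebius (n div d)))"
    proof (intro sum.cong refl)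
      fix j assume "j \<in> {..<m}"
      then show "{d. d dvd n \<and> [d = j] (mod m)} = {d. d dvd n \<and> d mod m = j}"
        by (auto simp: cong_def)
    next
      fix j d assume "d \<in> {d. d dvd n \<and> d mod m = j}"
      then show "poly (P j) (of_nat d) * of_int (moebius (n div d)) =
          of_nat (num_partitions k d) * of_int (moebius (n div d))"
        using P[of d] n by (auto intro: Nat.gr0I)
    qed
    \<comment> \<open>Each divisor lies in exactly one residue class modulo
      \<open>m\<close>.\<close>
    also have "\<dots> = (\<Sum>d | d dvd n. of_nat (num_partitions k d) * of_int (moebius (n div d)))"
      using sum.group[of "{d. d dvd n}" "{..<m}" "\<lambda>d. d mod m"] n m by (simp add: image_subset_iff)
    finally show "(\<Sum>j<m. \<Sum>t\<le>degree (P j). coeff (P j) t * ?g (t, j, m) n) =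
        of_nat (num_coprime_partitions k n)"
      using num_coprime_partitions_eq_moebius_sum[OF n] by simp
  qed
qed

section \<open>From modulo totients to root totients\<close>

text \<open>The sum is geometric with ratio \<open>w = z ^ d / z ^ j\<close>, an \<open>m\<close>-th
  root of unity that equals 1 exactly when the congruence holds.\<close>

lemma roots_of_unity_filter:
  fixes d j m :: nat
  assumes "j < m"
  defines "z \<equiv> cis (2 * pi / real m)"
  shows "(\<Sum>r<m. inverse (z ^ r) ^ j * (z ^ r) ^ d) = (if [d = j] (mod m) then of_nat m else 0)"
proof -
  have m: "m > 0" using assms by simp
  have z: "z ^ m = 1" "z \<noteq> 0" using m by (simp_all add: z_def DeMoivre)
  define w where "w = z ^ d / z ^ j"
  have sum_eq: "(\<Sum>r<m. inverse (z ^ r) ^ j * (z ^ r) ^ d) = (\<Sum>r<m. w ^ r)"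
    by (intro sum.cong refl)
      (simp add: w_def divide_inverse power_inverse power_mult_distrib mult.commute flip: power_mult)
  have wm: "w ^ m = 1"
    using z by (metis w_def power_divide power_mult mult.commute power_one div_by_1)
  have pow_mod: "z ^ n = z ^ (n mod m)" for n
  proof -
    have "z ^ (m * (n div m) + n mod m) = z ^ (n mod m)"
      unfolding power_add power_mult z by simp
    then show ?thesis by (simp only: mult_div_mod_eq)
  qed
  have inj: "z ^ a = z ^ b \<Longrightarrow> a = b" if "a < m" "b < m" for a b
  proof -
    assume eq: "z ^ a = z ^ b"
    have "inj_on (\<lambda>k. cis (2 * pi * real k / real m)) {..<m}"
      using bij_betw_roots_unity[OF m] by (simp add: bij_betw_def)
    moreover have "z ^ n = cis (2 * pi * real n / real m)" for n
      by (simp add: z_def DeMoivre mult.commute)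
    ultimately show "a = b" using that eq by (auto simp: inj_on_def)
  qed
  have w1: "w = 1 \<longleftrightarrow> [d = j] (mod m)"
  proof -
    have "w = 1 \<longleftrightarrow> z ^ (d mod m) = z ^ (j mod m)" using z by (simp add: w_def flip: pow_mod)
    also have "\<dots> \<longleftrightarrow> d mod m = j mod m" using inj m by auto
    finally show ?thesis by (simp add: cong_def)
  qed
  show ?thesis
  proof (cases "w = 1")
    case True
    then show ?thesis using w1 sum_eq by simp
  next
    case False
    then have "(\<Sum>r<m. w ^ r) = 0" using geometric_sum[of w m] wm by simp
    with False w1 sum_eq show ?thesis by simp
  qed
qed

text \<open>The filter turns the congruence condition on \<open>d\<close> into an average over the
  \<open>m\<close>-th roots of unity, each of which contributes one root totient.\<close>

lemma jordan_mod_totient_lin_comb_jordan_root_totient: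
  assumes "j < m"
  shows "lin_comb_on {1..} (\<lambda>(t, \<omega>). jordan_root_totient t \<omega>) {(t, \<omega>). root_of_unity \<omega>}
    (\<lambda>n. of_int (jordan_mod_totient t j m n))" (is "lin_comb_on _ ?g ?I _")
proof -
  define z where "z = cis (2 * pi / real m)"
  have m: "m > 0" using assms by simp
  have "root_of_unity (z ^ r)" for r
    unfolding root_of_unity_def
  proof (intro exI[of _ m] conjI)
    have "z ^ m = 1" using m by (simp add: z_def DeMoivre)
    then show "(z ^ r) ^ m = 1" by (metis power_mult mult.commute power_one)
  qed (use m in simp)
  then have "lin_comb_on {1..} ?g ?I
    (\<lambda>n. \<Sum>r<m. (inverse (z ^ r) ^ j / of_nat m) * ?g (t, z ^ r) n)"
    by (intro lin_comb_on_sum lin_comb_on_scale lin_comb_on_single) auto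
  then show ?thesis
  proof (rule lin_comb_on_cong)
    fix n :: nat assume "n \<in> {1..}"
    then have fin: "finite {d. d dvd n}" by simp
    have "(\<Sum>r<m. (inverse (z ^ r) ^ j / of_nat m) * ?g (t, z ^ r) n) =
      (\<Sum>d | d dvd n. (\<Sum>r<m. inverse (z ^ r) ^ j * (z ^ r) ^ d) / of_nat m *
         of_nat d ^ t * of_int (moebius (n div d)))"
      by (simp add: jordan_root_totient_def sum_distrib_left sum_distrib_right sum_divide_distrib
          mult.assoc) (subst sum.swap, simp)
    also have "\<dots> = (\<Sum>d | d dvd n. if [d = j] (mod m) then of_nat d ^ t * of_int (moebius (n div d)) else 0)"
      using m by (intro sum.cong refl) (simp add: z_def roots_of_unity_filter[OF assms])
    also have "\<dots> = of_int (jordan_mod_totient t j m n)"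
      using fin by (simp add: jordan_mod_totient_def sum.inter_filter [symmetric])
    finally show "(\<Sum>r<m. (inverse (z ^ r) ^ j / of_nat m) * ?g (t, z ^ r) n) =
      of_int (jordan_mod_totient t j m n)" .
  qed
qed


section \<open>Two and three parts\<close>

text \<open>The floor of \<open>n / 2\<close> in additive form: raising \<open>n\<close> by 2 adds
  one partition and keeps the parity.\<close>

lemma num_partitions_2: "2 * num_partitions 2 n + (if odd n then 1 else 0) = n"
proof (induction n rule: less_induct)
  case (less n)
  show ?case
  proof (cases "n < 2")
    case True
    then show ?thesis by (auto simp: num_partitions_eq_0 less_2_cases_iff)
  next
    case False
    then obtain m where m: "n = m + 2" by (metis add.commute le_Suc_ex not_less)
    have "num_partitions 2 (m + 2) = num_partitions 1 (m + 1) + num_partitions 2 m"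
      using num_partitions_rec[of 1 m] by (simp add: numeral_2_eq_2)
    also have "num_partitions 1 (m + 1) = 1" by (rule num_partitions_1) simp
    finally show ?thesis using less[of m] m by simp
  qed
qed

lemma num_partitions_3_rec: "num_partitions 3 (n + 3) = num_partitions 2 (n + 2) + num_partitions 3 n"
  using num_partitions_rec[of 2 n] by (simp add: eval_nat_numeral)

text \<open>The nearest integer to \<open>n\<^sup>2 / 12\<close> with its exact correction terms.
  These have period 6, so the induction goes in steps of 6 from six initial values.\<close>

lemma num_partitions_3:
  "12 * num_partitions 3 n + 1 + (if even n then 3 else 0) = n\<^sup>2 + (if 3 dvd n then 4 else 0)"
proof (induction n rule: less_induct)
  case (less n)
  show ?case
  proof (cases "n < 6")
    case True
    have p2: "num_partitions 2 2 = 1" "num_partitions 2 3 = 1" "num_partitions 2 4 = 2"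
      using num_partitions_2[of 2] num_partitions_2[of 3] num_partitions_2[of 4] by auto
    have "num_partitions 3 0 = 0" "num_partitions 3 1 = 0" "num_partitions 3 2 = 0"
      by (simp_all add: num_partitions_eq_0)
    moreover from this p2 have "num_partitions 3 3 = 1" "num_partitions 3 4 = 1" "num_partitions 3 5 = 2"
      using num_partitions_3_rec[of 0] num_partitions_3_rec[of 1] num_partitions_3_rec[of 2]
      by (simp_all add: eval_nat_numeral)
    moreover have "n \<in> {0, 1, 2, 3, 4, 5}" using True by auto
    ultimately show ?thesis by auto
  next
    case False
    then obtain m where m: "n = m + 6" by (metis add.commute le_Suc_ex not_less)
    have "num_partitions 3 (m + 6) = num_partitions 2 (m + 5) + (num_partitions 2 (m + 2) + num_partitions 3 m)"
      using num_partitions_3_rec[of "m + 3"] num_partitions_3_rec[of m] by (simp add: add.commute)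
    \<comment> \<open>The two arguments have opposite parity, so exactly one rounding term
      occurs.\<close>
    moreover have "num_partitions 2 (m + 5) + num_partitions 2 (m + 2) = m + 3"
      using num_partitions_2[of "m + 5"] num_partitions_2[of "m + 2"] by (auto split: if_splits)
    ultimately have "num_partitions 3 (m + 6) = num_partitions 3 m + m + 3" by simp
    moreover have "3 dvd (m + 6) \<longleftrightarrow> 3 dvd m" by presburger
    moreover have "(m + 6)\<^sup>2 = m\<^sup>2 + 12 * m + 36" by (simp add: power2_eq_square algebra_simps)
    ultimately show ?thesis using less[of m] m by simp
  qed
qed

text \<open>Divisor sums are compared: \<open>q * of_nat n ^ t\<close> is the divisor sum of the
  Jordan multiple, and the rest is that of \<open>h\<close>.\<close>

lemma num_coprime_partitions_eq_jordan_totient: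
  fixes q :: complex
  assumes "\<And>n. n > 0 \<Longrightarrow> of_nat (num_partitions k n) = q * of_nat n ^ t + (\<Sum>d | d dvd n. h d)"
    and "n > 0"
  shows "of_nat (num_coprime_partitions k n) = q * of_int (jordan_totient t n) + h n"
  using \<open>n > 0\<close>
proof (rule sum_divisors_cancel[rotated])
  fix n :: nat assume n: "n > 0"
  have "(\<Sum>d | d dvd n. of_nat (num_coprime_partitions k d)) = (of_nat (num_partitions k n) :: complex)"
    by (simp flip: sum_divisors_num_coprime_partitions[OF n])
  also have "\<dots> = q * of_int (\<Sum>d | d dvd n. jordan_totient t d) + (\<Sum>d | d dvd n. h d)"
    using assms(1)[OF n] by (simp add: sum_divisors_jordan_totient[OF n])
  also have "\<dots> = (\<Sum>d | d dvd n. q * of_int (jordan_totient t d) + h d)"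
    by (simp add: sum.distrib sum_distrib_left)
  finally show "(\<Sum>d | d dvd n. of_nat (num_coprime_partitions k d)) =
    (\<Sum>d | d dvd n. q * of_int (jordan_totient t d) + h d)" .
qed

lemma num_coprime_partitions_2:
  assumes "n > 2"
  shows "of_nat (num_coprime_partitions 2 n) = (1 / 2 :: complex) * of_int (jordan_totient 1 n)"
proof -
  \<comment> \<open>The rounding term \<open>- 1 / 2\<close> at odd \<open>n\<close> is
    \<open>- 1 / 2\<close> everywhere plus \<open>1 / 2\<close> when 2 divides \<open>n\<close>;
    these are the weights of the divisors 1 and 2.\<close>
  define h :: "nat \<Rightarrow> complex"
    where "h d = (if d = 1 then - 1 / 2 else 0) + (if d = 2 then 1 / 2 else 0)" for d
  have "of_nat (num_partitions 2 n) = (1 / 2) * of_nat n ^ 1 + (\<Sum>d | d dvd n. h d)" if "n > 0" for n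
  proof -
    have "(\<Sum>d | d dvd n. h d) = - 1 / 2 + (if 2 dvd n then 1 / 2 else 0)"
      using that by (simp add: h_def sum.distrib)
    moreover have "2 * of_nat (num_partitions 2 n) + (if odd n then 1 else 0) = (of_nat n :: complex)"
      using arg_cong[OF num_partitions_2[of n], of "of_nat :: nat \<Rightarrow> complex"] by auto
    ultimately show ?thesis by (cases "even n") (simp_all add: field_simps)
  qed
  from num_coprime_partitions_eq_jordan_totient[OF this, of n] assms show ?thesis
    by (simp add: h_def)
qed

lemma num_coprime_partitions_3:
  assumes "n > 3"
  shows "of_nat (num_coprime_partitions 3 n) = (1 / 12 :: complex) * of_int (jordan_totient 2 n)"
proof -
  \<comment> \<open>The corrections of the closed form divided by 12: -1 always, -3 for even
    \<open>n\<close>, 4 for multiples of 3.\<close>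
  define h :: "nat \<Rightarrow> complex"
    where "h d = (if d = 1 then - 1 / 12 else 0) + (if d = 2 then - 1 / 4 else 0) +
      (if d = 3 then 1 / 3 else 0)" for d
  have "of_nat (num_partitions 3 n) = (1 / 12) * of_nat n ^ 2 + (\<Sum>d | d dvd n. h d)" if "n > 0" for n
  proof -
    have h_sum: "(\<Sum>d | d dvd n. h d) = - 1 / 12 + (if 2 dvd n then - 1 / 4 else 0) + (if 3 dvd n then 1 / 3 else 0)"
      using that by (simp add: h_def sum.distrib)
    have "12 * of_nat (num_partitions 3 n) + 1 + (if even n then 3 else 0) =
        (of_nat n ^ 2 + (if 3 dvd n then 4 else 0) :: complex)"
      using arg_cong[OF num_partitions_3[of n], of "of_nat :: nat \<Rightarrow> complex"]
      by (auto simp: add.commute split: if_splits)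
    then show ?thesis unfolding h_sum by (cases "even n"; cases "3 dvd n") (simp_all add: field_simps)
  qed
  from num_coprime_partitions_eq_jordan_totient[OF this, of n] assms show ?thesis
    by (simp add: h_def)
qed

section \<open>Linear relations between Jordan totients at primes\<close>

lemma poly_eq_0_if_infinite_nat_zeros:
  fixes P :: "'a :: {idom, ring_char_0} poly"
  assumes "infinite A" "\<And>n. n \<in> A \<Longrightarrow> poly P (of_nat n) = 0"
  shows "P = 0"
proof (rule ccontr)
  assume "P \<noteq> 0"
  then have "finite {x. poly P x = 0}" by (rule poly_roots_finite)
  moreover have "of_nat ` A \<subseteq> {x. poly P x = 0}" using assms(2) by auto
  ultimately have "finite ((of_nat :: nat \<Rightarrow> 'a) ` A)" by (rule rev_finite_subset)
  with assms(1) show False by (simp add: finite_image_iff inj_on_def)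
qed

text \<open>At a prime \<open>p\<close> the function \<open>J\<^sub>t\<close> takes the value \<open>p\<^sup>t - 1\<close>, so a linear relation holding at
  infinitely many primes is a polynomial identity and therefore holds at every prime.\<close>

lemma lin_comb_jordan_on_prime:
  assumes "lin_comb_jordan_on {N..} f" and eq: "\<And>n. n \<ge> M \<Longrightarrow> f n = q * of_int (jordan_totient t n)"
    and p: "prime p" "N \<le> p"
  shows "f p = q * of_int (jordan_totient t p)"
proof -
  obtain S c where S: "finite S" "\<And>n. n \<ge> N \<Longrightarrow> f n = (\<Sum>i\<in>S. c i * of_int (jordan_totient i n))"
    using assms(1) unfolding lin_comb_on_def by auto
  define P where "P = (\<Sum>i\<in>S. smult (c i) (monom 1 i - 1)) - smult q (monom 1 t - 1)"
  have P: "poly P (of_nat r) = f r - q * of_int (jordan_totient t r)" if "prime r" "r \<ge> N" for r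
    using that S(2)[of r] by (simp add: P_def poly_sum poly_monom jordan_totient_prime)
  have "infinite ({r. prime r} - {..<max M N})"
    using primes_infinite by (intro Diff_infinite_finite) auto
  then have "P = 0"
    by (rule poly_eq_0_if_infinite_nat_zeros) (auto simp: P eq)
  then show ?thesis using P[OF p] by simp
qed

section \<open>Four or more parts\<close>

text \<open>A polynomial plus an \<open>L\<close>-periodic function has such differences. Stated
  through differences, the property passes directly through the partition recurrence.\<close>

definition eventually_poly_diff :: "nat \<Rightarrow> (nat \<Rightarrow> complex) \<Rightarrow> bool" where
  "eventually_poly_diff L f \<longleftrightarrow> (\<exists>C M. \<forall>n\<ge>M. f (n + L) - f n = poly C (of_nat n))"

text \<open>If the coprime count \<open>p'\<close> agrees with a linear combination of Jordan totients for large \<open>n\<close>,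
  the discrepancy \<open>h\<close> has finite support, so its divisor sum, which is the number of all partitions
  minus a polynomial, is periodic.\<close>

lemma lin_comb_jordan_on_imp_eventually_poly_diff:
  assumes "lin_comb_jordan_on {N..} (\<lambda>n. of_nat (num_coprime_partitions k n))"
  shows "eventually_poly_diff (12 * fact N) (\<lambda>n. of_nat (num_partitions k n))"
proof -
  \<comment> \<open>\<open>fact N\<close> is a multiple of every positive \<open>d < N\<close>, and
    the factor 12 makes \<open>?L\<close> a multiple of the shift used for four parts.\<close>
  let ?L = "12 * fact N :: nat"
  obtain S c where S: "finite S"
    "\<And>n. n \<ge> N \<Longrightarrow> of_nat (num_coprime_partitions k n) =
      (\<Sum>i\<in>S. c i * of_int (jordan_totient i n) :: complex)"
    using assms unfolding lin_comb_on_def by auto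
  define h where "h n = of_nat (num_coprime_partitions k n) - (\<Sum>i\<in>S. c i * of_int (jordan_totient i n))" for n
  define P where "P = (\<Sum>i\<in>S. smult (c i) (monom 1 i))"
  have h_sum: "(\<Sum>d | d dvd n. h d) = of_nat (num_partitions k n) - poly P (of_nat n)" if n: "n > 0" for n
  proof -
    have "(\<Sum>d | d dvd n. h d) = of_nat (\<Sum>d | d dvd n. num_coprime_partitions k d) -
        (\<Sum>i\<in>S. c i * of_int (\<Sum>d | d dvd n. jordan_totient i d))"
      by (simp add: h_def sum_subtractf sum_distrib_left) (rule sum.swap)
    then show ?thesis
      by (simp add: sum_divisors_num_coprime_partitions[OF n] sum_divisors_jordan_totient[OF n]
          P_def poly_sum poly_monom)
  qed
  have h_support: "(\<Sum>d | d dvd n. h d) = (\<Sum>d | d dvd n \<and> d < N. h d)" if "n > 0" for n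
    using that by (intro sum.mono_neutral_right) (auto simp: h_def S(2) not_less)
  have "of_nat (num_partitions k (n + ?L)) - of_nat (num_partitions k n) =
      poly (pcompose P [:of_nat ?L, 1:] - P) (of_nat n)" if "n \<ge> 1" for n
  proof -
    have "d dvd n + ?L \<longleftrightarrow> d dvd n" if "d < N" "d > 0" for d
      using that by (intro dvd_add_left_iff dvd_mult dvd_fact) auto
    moreover have "d > 0" if "d dvd n \<or> d dvd n + ?L" for d
      using that \<open>n \<ge> 1\<close> by (auto intro!: Nat.gr0I)
    ultimately have "{d. d dvd n + ?L \<and> d < N} = {d. d dvd n \<and> d < N}" by blast
    then have "(\<Sum>d | d dvd n + ?L. h d) = (\<Sum>d | d dvd n. h d)"
      using h_support[of n] h_support[of "n + ?L"] \<open>n \<ge> 1\<close> by simp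
    then have "of_nat (num_partitions k (n + ?L)) - poly P (of_nat (n + ?L)) =
        of_nat (num_partitions k n) - poly P (of_nat n)"
      using h_sum[of n] h_sum[of "n + ?L"] \<open>n \<ge> 1\<close> by simp
    then have "of_nat (num_partitions k (n + ?L)) - of_nat (num_partitions k n) =
        poly P (of_nat (n + ?L)) - poly P (of_nat n)"
      by (simp only: diff_eq_eq) (simp add: algebra_simps)
    then show ?thesis by (simp add: poly_pcompose add.commute)
  qed
  then show ?thesis unfolding eventually_poly_diff_def by blast
qed

text \<open>By the recurrence, the count for \<open>k\<close> is a difference of the count for
  \<open>Suc k\<close> with step \<open>Suc k\<close>. Differences with different steps commute, so
  its \<open>L\<close>-difference is a difference of the polynomial \<open>C\<close>.\<close>

lemma eventually_poly_diff_descend: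
  assumes "eventually_poly_diff L (\<lambda>n. of_nat (num_partitions (Suc k) n))"
  shows "eventually_poly_diff L (\<lambda>n. of_nat (num_partitions k n))"
proof -
  let ?p = "\<lambda>k n. of_nat (num_partitions k n) :: complex"
  obtain C M where C: "\<And>n. n \<ge> M \<Longrightarrow> ?p (Suc k) (n + L) - ?p (Suc k) n = poly C (of_nat n)"
    using assms unfolding eventually_poly_diff_def by blast
  have rec: "?p k (n + k) = ?p (Suc k) (n + Suc k) - ?p (Suc k) n" for n
    by (simp only: num_partitions_rec of_nat_add) simp
  \<comment> \<open>With \<open>m = n + k\<close>, the two compositions evaluate \<open>C\<close> at
    \<open>n + Suc k\<close> and at \<open>n\<close>.\<close>
  have "?p k (m + L) - ?p k m = poly (pcompose C [:1, 1:] - pcompose C [:- of_nat k, 1:]) (of_nat m)"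
    if "m \<ge> M + k" for m
  proof -
    obtain n where n: "m = n + k" "n \<ge> M" using \<open>m \<ge> M + k\<close>
      by (metis add.commute add_le_cancel_right le_add_diff_inverse2 le_trans le_add2)
    have "?p k (m + L) - ?p k m =
      (?p (Suc k) (n + L + Suc k) - ?p (Suc k) (n + L)) - (?p (Suc k) (n + Suc k) - ?p (Suc k) n)"
      unfolding rec[symmetric] by (simp add: n add_ac)
    also have "\<dots> = (?p (Suc k) ((n + Suc k) + L) - ?p (Suc k) (n + Suc k)) - (?p (Suc k) (n + L) - ?p (Suc k) n)"
      by (simp add: add_ac)
    also have "\<dots> = poly C (of_nat (n + Suc k)) - poly C (of_nat n)"
      using n by (simp only: C le_add1 trans_le_add1)
    finally show ?thesis by (simp add: n poly_pcompose add_ac)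
  qed
  then show ?thesis unfolding eventually_poly_diff_def by blast
qed

lemma num_partitions_4_rec: "num_partitions 4 (n + 4) = num_partitions 3 (n + 3) + num_partitions 4 n"
  using num_partitions_rec[of 3 n] by (simp add: eval_nat_numeral)

text \<open>Three steps of the recurrence bring in three-part counts at \<open>n + 11\<close>,
  \<open>n + 7\<close> and \<open>n + 3\<close>. These arguments cover all residues modulo 3, so the
  divisibility terms add up to a constant; they share one parity, so the parity terms add up to 9 or
  0.\<close>

lemma num_partitions_4_shift:
  "12 * num_partitions 4 (n + 12) + (if odd n then 9 else 0) =
   12 * num_partitions 4 n + 3 * n\<^sup>2 + 42 * n + 180"
proof -
  have "num_partitions 4 (n + 12) =
      num_partitions 3 (n + 11) + num_partitions 3 (n + 7) + num_partitions 3 (n + 3) + num_partitions 4 n"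
    using num_partitions_4_rec[of n] num_partitions_4_rec[of "n + 4"] num_partitions_4_rec[of "n + 8"]
    by (simp add: add.assoc)
  moreover have "(if 3 dvd n + 11 then 4 else 0) + (if 3 dvd n + 7 then 4 else 0) +
      (if 3 dvd n + 3 then 4 else 0) = (4 :: nat)"
    by presburger
  moreover have "(n + 11)\<^sup>2 + (n + 7)\<^sup>2 + (n + 3)\<^sup>2 = 3 * n\<^sup>2 + 42 * n + 179"
    by (simp add: power2_eq_square algebra_simps)
  ultimately show ?thesis
    using num_partitions_3[of "n + 11"] num_partitions_3[of "n + 7"] num_partitions_3[of "n + 3"]
    by (cases "even n") (simp_all del: dvd_add_triv_right_iff)
qed

text \<open>The \<open>9\<close> contributed only by odd \<open>n\<close> reflects the double pole of the generating function
  of the partitions into four parts at \<open>- 1\<close>.\<close>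

lemma not_eventually_poly_diff_4:
  assumes "s > 0"
  shows "\<not> eventually_poly_diff (12 * s) (\<lambda>n. of_nat (num_partitions 4 n))"
proof
  let ?p = "\<lambda>n. of_nat (num_partitions 4 n) :: complex"
  assume "eventually_poly_diff (12 * s) ?p"
  then obtain C M where C: "\<And>n. n \<ge> M \<Longrightarrow> ?p (n + 12 * s) - ?p n = poly C (of_nat n)"
    unfolding eventually_poly_diff_def by blast
  \<comment> \<open>\<open>B s\<close> collects the polynomial increments of \<open>s\<close>
    consecutive shifts by 12. Since 12 is even, the parity term repeats \<open>s\<close>
    times.\<close>
  define B where "B s = (\<Sum>j<s. pcompose [:180, 42, 3:] [:of_nat (12 * j), 1 :: complex:])" for s
  have shift: "12 * ?p (n + 12 * s) + (if odd n then 9 * of_nat s else 0) = 12 * ?p n + poly (B s) (of_nat n)" for n s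
  proof (induction s)
    case (Suc s)
    have "12 * ?p (n + 12 * s + 12) + (if odd n then 9 else 0) =
        12 * ?p (n + 12 * s) + poly (pcompose [:180, 42, 3:] [:of_nat (12 * s), 1:]) (of_nat n)"
      using arg_cong[OF num_partitions_4_shift[of "n + 12 * s"], of "of_nat :: nat \<Rightarrow> complex"]
      by (auto simp: poly_pcompose algebra_simps power2_eq_square split: if_splits)
    moreover have "n + 12 * Suc s = n + 12 * s + 12" by simp
    ultimately have "12 * ?p (n + 12 * s) = 12 * ?p (n + 12 * Suc s) + (if odd n then 9 else 0) -
        poly (pcompose [:180, 42, 3:] [:of_nat (12 * s), 1:]) (of_nat n)"
      by (simp only: eq_diff_eq)
    from Suc[unfolded this] show ?case
      by (simp add: B_def algebra_simps diff_eq_eq split: if_splits)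
  qed (simp add: B_def)
  \<comment> \<open>\<open>R\<close> vanishes at large even arguments, hence identically, yet its
    value at large odd ones is \<open>- 9 * of_nat s\<close>.\<close>
  define R where "R = smult 12 C - B s"
  have R: "poly R (of_nat n) = (if odd n then - 9 * of_nat s else 0)" if "n \<ge> M" for n
  proof -
    have "?p (n + 12 * s) = ?p n + poly C (of_nat n)"
      using C[OF that] by (simp add: diff_eq_eq add.commute)
    from shift[of n s, unfolded this] show ?thesis
      by (auto simp: R_def algebra_simps split: if_splits)
  qed
  have "infinite {n. n \<ge> M \<and> even n}"
    unfolding infinite_nat_iff_unbounded_le
  proof
    fix m show "\<exists>n\<ge>m. n \<in> {n. n \<ge> M \<and> even n}"
      by (rule exI[of _ "2 * (m + M)"]) auto
  qed
  then have "R = 0"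
    by (rule poly_eq_0_if_infinite_nat_zeros) (auto simp: R)
  with R[of "2 * M + 1"] assms show False by simp
qed

text \<open>Polynomial shift differences descend from \<open>k\<close> to 4, where they are
  impossible.\<close>

lemma lin_comb_jordan_on_imp_le_3:
  assumes "lin_comb_jordan_on {N..} (\<lambda>n. of_nat (num_coprime_partitions k n))"
  shows "k \<le> 3"
proof (rule ccontr)
  assume "\<not> k \<le> 3"
  then have "4 \<le> k" by simp
  then have "eventually_poly_diff (12 * fact N) (\<lambda>n. of_nat (num_partitions 4 n))"
  proof (induction rule: inc_induct)
    case base
    show ?case by (rule lin_comb_jordan_on_imp_eventually_poly_diff[OF assms])
  qed (rule eventually_poly_diff_descend)
  then show False using not_eventually_poly_diff_4[of "fact N"] by simp
qed

section \<open>Coprime counts as combinations of totient functions\<close>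

theorem theorem5p1:
  fixes k :: nat and p' :: "nat \<Rightarrow> complex"
  defines "p' \<equiv> \<lambda>n. of_nat (num_coprime_partitions k n)"
  assumes "k \<ge> 2"
  shows
    "lin_comb_on {1..} (\<lambda>(t, \<omega>). jordan_root_totient t \<omega>) {(t, \<omega>). root_of_unity \<omega>} p' \<and>
     lin_comb_on {1..} (\<lambda>(t, j, m) n. of_int (jordan_mod_totient t j m n))
       {(t, j, m). m \<ge> 1 \<and> j < m} p' \<and>
     \<not> lin_comb_jordan_on {1..} p' \<and>
     (\<forall>N\<ge>1. lin_comb_jordan_on {N..} p' \<longrightarrow>
        (\<exists>q::rat. \<forall>n\<ge>N. p' n = of_rat q * of_int (jordan_totient (k - 1) n)) \<and> k \<in> {2, 3}) \<and>
     (k \<in> {2, 3} \<longrightarrow>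
        lin_comb_jordan_on {k + 1..} p' \<and>
        (\<forall>N\<ge>1. lin_comb_jordan_on {N..} p' \<longrightarrow> k + 1 \<le> N))"
proof -
  have mod: "lin_comb_on {1..} (\<lambda>(t, j, m) n. of_int (jordan_mod_totient t j m n))
      {(t, j, m). m \<ge> 1 \<and> j < m} p'"
    unfolding p'_def using \<open>k \<ge> 2\<close> by (intro lin_comb_jordan_mod_totient) simp
  have root: "lin_comb_on {1..} (\<lambda>(t, \<omega>). jordan_root_totient t \<omega>) {(t, \<omega>). root_of_unity \<omega>} p'"
    by (rule lin_comb_on_trans[OF mod])
      (use jordan_mod_totient_lin_comb_jordan_root_totient in auto)
  \<comment> \<open>The leading coefficients of the closed forms for two and three parts.\<close>
  define q :: rat where "q = (if k = 2 then 1 / 2 else 1 / 12)"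
  have multiple: "p' n = of_rat q * of_int (jordan_totient (k - 1) n)" if "k \<in> {2, 3}" "n \<ge> k + 1" for n
    using that num_coprime_partitions_2[of n] num_coprime_partitions_3[of n]
    by (auto simp: p'_def q_def of_rat_divide)
  have small: "k \<in> {2, 3}" if "lin_comb_jordan_on {N..} p'" for N
    using lin_comb_jordan_on_imp_le_3 that \<open>k \<ge> 2\<close> unfolding p'_def by force
  have minimal: "k + 1 \<le> N" if N: "lin_comb_jordan_on {N..} p'" for N
  proof (rule ccontr)
    assume "\<not> k + 1 \<le> N"
    then have "N \<le> k" by simp
    \<comment> \<open>Both 2 and 3 are prime, so a combination valid at \<open>k\<close> forces the
      Jordan multiple there as well. That multiple is 1/2 or 2/3, whereas the count at
      \<open>k\<close> is 1.\<close>
    moreover have k: "prime k" using small[OF N] by auto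
    ultimately have "p' k = of_rat q * of_int (jordan_totient (k - 1) k)"
      using lin_comb_jordan_on_prime[OF N, of "k + 1" "of_rat q" "k - 1" k] multiple[OF small[OF N]]
      by blast
    moreover have "p' k = 1" using \<open>k \<ge> 2\<close> by (simp add: p'_def num_coprime_partitions_self)
    ultimately show False
      using small[OF N] jordan_totient_prime[OF k] by (auto simp: q_def of_rat_divide)
  qed
  have "lin_comb_jordan_on {k + 1..} p'" if "k \<in> {2, 3}"
  proof (rule lin_comb_on_cong)
    show "lin_comb_jordan_on {k + 1..} (\<lambda>n. of_rat q * of_int (jordan_totient (k - 1) n))"
      by (intro lin_comb_on_scale lin_comb_on_single) simp
  qed (use multiple[OF that] in simp)
  moreover have "\<exists>q::rat. \<forall>n\<ge>N. p' n = of_rat q * of_int (jordan_totient (k - 1) n)"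
    if N: "lin_comb_jordan_on {N..} p'" for N
    using multiple[OF small[OF N]] minimal[OF N] by (meson le_trans)
  moreover have "\<not> lin_comb_jordan_on {1..} p'" using minimal[of 1] \<open>k \<ge> 2\<close> by auto
  ultimately show ?thesis using root mod small minimal by blast
qed

end
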